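(* Let $\Sigma$ be the equation system (in the signature $\{+,\cdot\}$) that consists of (1) the $\boldsymbol{\ell}_n$-free laws, for all $n\geq 1$; (2) the $x^2$-free laws; (3) the laws defining anticommutative ai-semirings. Then $\Sigma$ is not finitely based; that is, the variety defined by $\Sigma$ cannot be defined by finitely many identities.
   Context: An ai-semiring (additively idempotent semiring) is an algebra $(S,+,\cdot)$ such that $(S,+)$ is a commutative idempotent semigroup, $(S,\cdot)$ is a semigroup, and $(x+y)z\approx xz+yz$, $x(y+z)\approx xy+xz$ hold. The laws defining anticommutative ai-semirings are the ai-semiring axioms together with $xy+yx\approx xy+yx+z\approx (xy+yx)z\approx z(xy+yx)$. For a (noncommutative) semigroup word $\mathbf{v}$, the $\mathbf{v}$-free laws are $\mathbf{v}\approx \mathbf{v}+z\approx z\mathbf{v}\approx \mathbf{v}z$, where $z$ is a variable not occurring in $\mathbf{v}$. For $n\geq 1$, $$\boldsymbol{\ell}_n:=x_1\cdot\Big(\prod_{1\leq i\leq n-1}(x_{i+1}x_i)\Big)\cdot x_n=x_1x_2x_1x_3x_2x_4x_3\cdots x_nx_{n-1}x_n,$$ where the product is taken in increasing order of $i$. *)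

theory Defs
  imports Main
begin

datatype trm =
    Var nat
  | Add trm trm  (infixl "\<^bold>+" 65)
  | Mul trm trm  (infixl "\<^bold>*" 70)

type_synonym identity = "trm \<times> trm"

text \<open>Only the behaviour of the operations on the carrier is relevant.\<close>

record 'a alg =
  carr :: "'a set"
  add :: "'a \<Rightarrow> 'a \<Rightarrow> 'a"
  mul :: "'a \<Rightarrow> 'a \<Rightarrow> 'a"

definition is_alg :: "'a alg \<Rightarrow> bool" where
  "is_alg A \<longleftrightarrow> carr A \<noteq> {} \<and>
     (\<forall>x \<in> carr A. \<forall>y \<in> carr A. add A x y \<in> carr A \<and> mul A x y \<in> carr A)"

primrec eval_trm :: "'a alg \<Rightarrow> (nat \<Rightarrow> 'a) \<Rightarrow> trm \<Rightarrow> 'a" where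
  "eval_trm A \<rho> (Var x) = \<rho> x"
| "eval_trm A \<rho> (s \<^bold>+ t) = add A (eval_trm A \<rho> s) (eval_trm A \<rho> t)"
| "eval_trm A \<rho> (s \<^bold>* t) = mul A (eval_trm A \<rho> s) (eval_trm A \<rho> t)"

definition satisfies :: "'a alg \<Rightarrow> identity \<Rightarrow> bool" where
  "satisfies A e \<longleftrightarrow>
     (\<forall>\<rho>. range \<rho> \<subseteq> carr A \<longrightarrow> eval_trm A \<rho> (fst e) = eval_trm A \<rho> (snd e))"

text \<open>
  HOL cannot quantify over algebras on all types at once, so this is the class of models
  whose carrier is a subset of the type \<open>'a\<close>. Two sets of identities (over countably many
  variables) define the same variety iff they have the same models with carriers in
  \<open>'a\<close>, for any one infinite type \<open>'a\<close>: an identity fails in some model iff it fails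
  in a countable one.
\<close>

definition variety :: "identity set \<Rightarrow> 'a alg set" where
  "variety E = {A. is_alg A \<and> (\<forall>e \<in> E. satisfies A e)}"

text \<open>The chain \<open>t\<^sub>1 \<approx> t\<^sub>2 \<approx> \<dots> \<approx> t\<^sub>k\<close>, given by its list of terms.\<close>

definition laws :: "trm list \<Rightarrow> identity set" where
  "laws ts = set (zip ts (tl ts))"

definition ai_semiring_laws :: "identity set" where
  "ai_semiring_laws = (let x = Var 0; y = Var 1; z = Var 2 in
     laws [(x \<^bold>+ y) \<^bold>+ z, x \<^bold>+ (y \<^bold>+ z)] \<union>
     laws [x \<^bold>+ y, y \<^bold>+ x] \<union>
     laws [x \<^bold>+ x, x] \<union>
     laws [(x \<^bold>* y) \<^bold>* z, x \<^bold>* (y \<^bold>* z)] \<union>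
     laws [(x \<^bold>+ y) \<^bold>* z, x \<^bold>* z \<^bold>+ y \<^bold>* z] \<union>
     laws [x \<^bold>* (y \<^bold>+ z), x \<^bold>* y \<^bold>+ x \<^bold>* z])"

definition anticommutative_laws :: "identity set" where
  "anticommutative_laws = ai_semiring_laws \<union>
     (let x = Var 0; y = Var 1; z = Var 2; c = x \<^bold>* y \<^bold>+ y \<^bold>* x in
        laws [c, c \<^bold>+ z, c \<^bold>* z, z \<^bold>* c])"

text \<open>
  Semigroup words are nonempty lists of variables; \<open>word\<close> turns one into a term,
  bracketed to the left, and is left unspecified on the empty list.
\<close>

fun word :: "nat list \<Rightarrow> trm" where
  "word (x # xs) = foldl (\<lambda>t y. t \<^bold>* Var y) (Var x) xs"

text \<open>
  One copy of the laws for each variable \<open>z\<close> not in \<open>v\<close>; these copies differ only by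
  renaming \<open>z\<close>.
\<close>

definition free_laws :: "nat list \<Rightarrow> identity set" where
  "free_laws v =
     (\<Union>z \<in> - set v. laws [word v, word v \<^bold>+ Var z, Var z \<^bold>* word v, word v \<^bold>* Var z])"

text \<open>For \<open>n = 1\<close> the inner product is empty, so \<open>ell 1\<close> is the word \<open>x\<^sub>1x\<^sub>1\<close>.\<close>

definition ell :: "nat \<Rightarrow> nat list" where
  "ell n = [1] @ concat (map (\<lambda>i. [i + 1, i]) [1..<n]) @ [n]"

definition Sigma_laws :: "identity set" where
  "Sigma_laws = (\<Union>n \<in> {1..}. free_laws (ell n)) \<union> free_laws [0, 0] \<union> anticommutative_laws"

end

theory Submission
  imports Defs "HOL-Library.Sublist" "HOL-Library.Countable"
begin

text \<open>
  For \<open>m \<ge> 3\<close> let \<open>A\<^sub>m\<close> be the Rees quotient of the free semigroup by the ideal of words that are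
  not factors of \<open>\<ell>\<^sub>m\<close>, with the flat addition in which the sum of two distinct elements is
  zero. The gaps between the two occurrences of a letter of \<open>\<ell>\<^sub>m\<close> are 3, except that the first
  and the last gap are 2. Hence \<open>\<ell>\<^sub>m\<close> is square-free, and the only substitution instance of some
  \<open>\<ell>\<^sub>n\<close> that is a factor of \<open>\<ell>\<^sub>m\<close> is \<open>\<ell>\<^sub>m\<close> itself under the identity substitution. So \<open>A\<^sub>m\<close>
  violates the \<open>\<ell>\<^sub>m\<close>-free laws, but removing any one of the \<open>m\<close> letters of \<open>\<ell>\<^sub>m\<close>, which are
  irreducible, leaves a subalgebra that satisfies \<open>\<Sigma>\<close>. An assignment of fewer than \<open>m\<close> variables
  in \<open>A\<^sub>m\<close> misses a letter, so \<open>A\<^sub>m\<close> satisfies every consequence of \<open>\<Sigma>\<close> in fewer than \<open>m\<close>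
  variables.
\<close>

section \<open>Terms and isomorphic copies\<close>

primrec vars :: "trm \<Rightarrow> nat set" where
  "vars (Var x) = {x}"
| "vars (s \<^bold>+ t) = vars s \<union> vars t"
| "vars (s \<^bold>* t) = vars s \<union> vars t"

lemma finite_vars [simp]: "finite (vars t)"
  by (induction t) auto

lemma eval_trm_cong: "(\<And>x. x \<in> vars t \<Longrightarrow> \<rho> x = \<sigma> x) \<Longrightarrow> eval_trm A \<rho> t = eval_trm A \<sigma> t"
  by (induction t) auto

text \<open>Carries algebras on \<open>nat list\<close> over to the type \<open>'a\<close> of the
  theorem. \<open>inv f\<close> is meaningful only on the range of \<open>f\<close>, which contains
  the carrier of the copy.\<close>

definition image_alg :: "('a \<Rightarrow> 'b) \<Rightarrow> 'a alg \<Rightarrow> 'b alg" where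
  "image_alg f A = \<lparr>carr = f ` carr A,
     add = (\<lambda>x y. f (add A (inv f x) (inv f y))),
     mul = (\<lambda>x y. f (mul A (inv f x) (inv f y)))\<rparr>"

lemma eval_image_alg:
  assumes "inj f"
  shows "eval_trm (image_alg f A) (f \<circ> \<rho>) t = f (eval_trm A \<rho> t)"
  by (induction t) (auto simp: image_alg_def assms)

lemma satisfies_image_alg:
  fixes f :: "'a \<Rightarrow> 'b"
  assumes "inj f"
  shows "satisfies (image_alg f A) e \<longleftrightarrow> satisfies A e"
proof
  assume L: "satisfies (image_alg f A) e"
  show "satisfies A e"
    unfolding satisfies_def
  proof (intro allI impI)
    fix \<rho> :: "nat \<Rightarrow> 'a" assume "range \<rho> \<subseteq> carr A"
    then have "range (f \<circ> \<rho>) \<subseteq> carr (image_alg f A)"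
      by (auto simp: image_alg_def)
    with L have "eval_trm (image_alg f A) (f \<circ> \<rho>) (fst e) = eval_trm (image_alg f A) (f \<circ> \<rho>) (snd e)"
      unfolding satisfies_def by blast
    then show "eval_trm A \<rho> (fst e) = eval_trm A \<rho> (snd e)"
      using assms by (simp add: eval_image_alg inj_eq)
  qed
next
  assume R: "satisfies A e"
  show "satisfies (image_alg f A) e"
    unfolding satisfies_def
  proof (intro allI impI)
    fix \<rho> :: "nat \<Rightarrow> 'b" assume \<rho>: "range \<rho> \<subseteq> carr (image_alg f A)"
    then have "\<rho> x \<in> f ` carr A" for x
      by (auto simp: image_alg_def)
    then have "inv f (\<rho> x) \<in> carr A \<and> f (inv f (\<rho> x)) = \<rho> x" for x
      using assms by (metis imageE inv_f_f)
    then have 1: "range (inv f \<circ> \<rho>) \<subseteq> carr A" and 2: "\<rho> = f \<circ> (inv f \<circ> \<rho>)"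
      by (auto simp: fun_eq_iff)
    from R 1 have "eval_trm A (inv f \<circ> \<rho>) (fst e) = eval_trm A (inv f \<circ> \<rho>) (snd e)"
      unfolding satisfies_def by blast
    then show "eval_trm (image_alg f A) \<rho> (fst e) = eval_trm (image_alg f A) \<rho> (snd e)"
      by (subst (1 2) 2) (simp add: eval_image_alg assms del: o_apply)
  qed
qed

lemma image_alg_in_variety_iff:
  assumes "inj f"
  shows "image_alg f A \<in> variety E \<longleftrightarrow> A \<in> variety E"
proof -
  have "is_alg (image_alg f A) \<longleftrightarrow> is_alg A"
    using assms by (simp add: is_alg_def image_alg_def inj_image_mem_iff)
  then show ?thesis
    using assms by (simp add: variety_def satisfies_image_alg)
qed

section \<open>Flat algebras of factors of a word\<close>

text \<open>
  The empty list plays the role of zero. Words that are not factors of \<open>w\<close> may belong to the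
  carrier; they are harmless, since all products with them are zero.
\<close>

definition factor_alg :: "nat list \<Rightarrow> nat list set \<Rightarrow> nat list alg" where
  "factor_alg w S = \<lparr>carr = S,
     add = (\<lambda>x y. if x = y then x else []),
     mul = (\<lambda>x y. if x \<noteq> [] \<and> y \<noteq> [] \<and> sublist (x @ y) w then x @ y else [])\<rparr>"

lemma carr_factor_alg [simp]: "carr (factor_alg w S) = S"
  and add_factor_alg [simp]: "add (factor_alg w S) x y = (if x = y then x else [])"
  and mul_factor_alg: "mul (factor_alg w S) x y =
        (if x \<noteq> [] \<and> y \<noteq> [] \<and> sublist (x @ y) w then x @ y else [])"
  by (simp_all add: factor_alg_def)

lemma eval_factor_alg_carr:
  "eval_trm (factor_alg w S) \<rho> t = eval_trm (factor_alg w T) \<rho> t"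
  by (induction t) (simp_all add: mul_factor_alg)

lemma is_alg_factor_alg: "is_alg (factor_alg w UNIV)"
  by (simp add: is_alg_def)

text \<open>A nonzero product has length at least 2, and a nonzero sum equals both summands, so
  \<open>[a]\<close> arises only from itself.\<close>

lemma is_alg_factor_alg_remove_letter: "is_alg (factor_alg w (- {[a]}))"
  by (auto simp: is_alg_def mul_factor_alg append_eq_Cons_conv intro: exI[of _ "[]"])

lemma mul_factor_alg_assoc:
  "mul (factor_alg w S) (mul (factor_alg w S) x y) z = mul (factor_alg w S) x (mul (factor_alg w S) y z)"
proof -
  have "sublist (x @ y) w" "sublist (y @ z) w" if "sublist (x @ y @ z) w"
    using that by (auto simp: sublist_def) (metis append.assoc)+
  then show ?thesis
    by (auto simp: mul_factor_alg)
qed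

text \<open>Distributivity rests on cancellation: for x and y distinct, xz and yz cannot be equal
  and nonzero, so both sides are zero.\<close>

lemma satisfies_ai_semiring_laws:
  assumes "e \<in> ai_semiring_laws"
  shows "satisfies (factor_alg w S) e"
  using assms
  by (auto simp: ai_semiring_laws_def laws_def satisfies_def Let_def mul_factor_alg_assoc)
     (auto simp: mul_factor_alg split: if_splits)

text \<open>Commuting words are powers of a common word z; both exponents are positive here, so
  their product begins with zz.\<close>

lemma commuting_words_square:
  assumes "x @ y = y @ x" "x \<noteq> []" "y \<noteq> []"
  obtains z where "z \<noteq> []" "sublist (z @ z) (x @ y)"
proof -
  obtain k l z where z: "concat (replicate k z) = x" "concat (replicate l z) = y"
    using comm_append_are_replicate[OF assms(1)] by auto
  with assms obtain k' l' where "k = Suc k'" "l = Suc l'"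
    by (metis concat.simps(1) not0_implies_Suc replicate_0)
  then have "x @ y = concat (replicate (Suc (Suc (k' + l'))) z)"
    using z replicate_add[of "Suc k'" "Suc l'" z] by (metis add_Suc add_Suc_right concat_append)
  then have "x @ y = [] @ (z @ z) @ concat (replicate (k' + l') z)"
    by simp
  moreover have "z \<noteq> []"
    using z assms by auto
  ultimately show thesis
    using that by (metis sublist_appendI)
qed

lemma satisfies_anticommutative_laws:
  assumes "e \<in> anticommutative_laws" and square_free: "\<And>z. sublist (z @ z) w \<Longrightarrow> z = []"
  shows "satisfies (factor_alg w S) e"
proof -
  let ?A = "factor_alg w S"
  have zero: "add ?A (mul ?A x y) (mul ?A y x) = []" for x y
  proof (rule ccontr)
    assume "add ?A (mul ?A x y) (mul ?A y x) \<noteq> []"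
    then have "x @ y = y @ x" "x \<noteq> []" "y \<noteq> []" "sublist (x @ y) w"
      by (auto simp: mul_factor_alg split: if_splits)
    then show False
      by (meson commuting_words_square square_free sublist_order.order.trans)
  qed
  show ?thesis
    using assms(1) satisfies_ai_semiring_laws[of e w S]
    by (auto simp: anticommutative_laws_def laws_def satisfies_def Let_def zero simp del: add_factor_alg)
       (auto simp: mul_factor_alg)
qed

lemma word_snoc: "v \<noteq> [] \<Longrightarrow> word (v @ [y]) = word v \<^bold>* Var y"
  by (cases v) auto

text \<open>Zero is absorbing, so no partial product vanishes. A single variable involves no
  product, and its value need not be a factor of \<open>w\<close>; hence the length
  condition.\<close>

lemma eval_word_nonzero:
  assumes "v \<noteq> []" "eval_trm (factor_alg w S) \<rho> (word v) \<noteq> []"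
  shows "eval_trm (factor_alg w S) \<rho> (word v) = concat (map \<rho> v)
    \<and> (\<forall>x \<in> set v. \<rho> x \<noteq> []) \<and> (length v \<ge> 2 \<longrightarrow> sublist (concat (map \<rho> v)) w)"
  using assms
proof (induction v rule: rev_induct)
  case (snoc y v)
  then show ?case
    by (cases "v = []") (auto simp: word_snoc mul_factor_alg split: if_splits)
qed simp

lemma eval_word_letters:
  assumes "v \<noteq> []" "sublist v w"
  shows "eval_trm (factor_alg w S) (\<lambda>x. [x]) (word v) = v"
  using assms
proof (induction v rule: rev_induct)
  case (snoc y v)
  then have "sublist v w"
    by (meson sublist_appendI sublist_append_rightI sublist_order.order.trans)
  with snoc show ?case
    by (cases "v = []") (auto simp: word_snoc mul_factor_alg)
qed simp

lemma satisfies_free_laws: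
  assumes "e \<in> free_laws v"
    and "\<And>\<rho>. range \<rho> \<subseteq> S \<Longrightarrow> eval_trm (factor_alg w S) \<rho> (word v) = []"
  shows "satisfies (factor_alg w S) e"
  using assms by (auto simp: free_laws_def laws_def satisfies_def mul_factor_alg)

lemma not_satisfies_free_laws:
  assumes "w \<noteq> []"
  shows "\<exists>e \<in> free_laws w. \<not> satisfies (factor_alg w UNIV) e"
proof -
  obtain z where z: "z \<notin> set w"
    using ex_new_if_finite[of "set w"] by auto
  \<comment> \<open>Letters stand for themselves, which gives \<open>word w\<close> the value
    \<open>w\<close>, while the fresh variable is sent to zero and annihilates the sum.\<close>
  let ?\<rho> = "(\<lambda>x. [x])(z := [])"
  have vars: "vars (word w) \<subseteq> set w"
    using assms by (induction w rule: rev_nonempty_induct) (auto simp: word_snoc)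
  have "eval_trm (factor_alg w UNIV) ?\<rho> (word w) = eval_trm (factor_alg w UNIV) (\<lambda>x. [x]) (word w)"
    using vars z by (intro eval_trm_cong) auto
  also have "\<dots> = w"
    using assms by (intro eval_word_letters) auto
  finally have "\<not> satisfies (factor_alg w UNIV) (word w, word w \<^bold>+ Var z)"
    using assms by (auto simp: satisfies_def intro!: exI[of _ ?\<rho>])
  moreover have "(word w, word w \<^bold>+ Var z) \<in> free_laws w"
    using z by (auto simp: free_laws_def laws_def)
  ultimately show ?thesis
    by blast
qed

section \<open>Factors of \<open>\<ell>\<^sub>m\<close>\<close>

lemma ell_Suc: "n \<ge> 1 \<Longrightarrow> ell (Suc n) = butlast (ell n) @ [n + 1, n, n + 1]"
  by (simp add: ell_def butlast_append)

lemma length_ell: "n \<ge> 1 \<Longrightarrow> length (ell n) = 2 * n"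
  by (induction n rule: nat_induct_at_least) (simp_all add: ell_Suc, simp add: ell_def)

text \<open>Counting from 0, letter i sits at positions 2i-3 and 2i, except that letter 1 starts at
  0 and letter n ends at 2n-1.\<close>

lemma nth_ell:
  assumes "n \<ge> 1" "p < 2 * n"
  shows "ell n ! p =
    (if p = 0 then 1 else if p = 2 * n - 1 then n else if even p then p div 2 else p div 2 + 2)"
  using assms
proof (induction n arbitrary: p rule: nat_induct_at_least)
  case base
  then show ?case
    by (auto simp: ell_def nth_Cons')
next
  case (Suc n)
  then have "p < 2 * n - 1 \<or> p = 2 * n - 1 \<or> p = 2 * n \<or> p = 2 * n + 1"
    by auto
  then show ?case
    using Suc.IH[of p] Suc.hyps
    by (auto simp: ell_Suc nth_append length_ell nth_butlast)
qed

text \<open>The three cases are the letter 1, the letters strictly between 1 and m, and the letter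
  m.\<close>

lemma ell_repetition:
  assumes "m \<ge> 2" "p < q" "q < 2 * m" "ell m ! p = ell m ! q"
  shows "p = 0 \<and> q = 2 \<or> odd p \<and> p < 2 * m - 3 \<and> q = p + 3 \<or> p = 2 * m - 3 \<and> q = 2 * m - 1"
  using assms by (auto simp: nth_ell split: if_splits elim!: evenE oddE)

lemma letter_ell_twice:
  assumes "1 \<le> i" "i \<le> n"
  obtains p q where "p < q" "q < 2 * n" "ell n ! p = i" "ell n ! q = i"
proof (rule that)
  let ?p = "if i = 1 then 0 else 2 * i - 3" and ?q = "if i = n then 2 * n - 1 else 2 * i"
  show "?p < ?q" "?q < 2 * n" using assms by auto
  show "ell n ! ?p = i" "ell n ! ?q = i"
    using assms by (auto simp: nth_ell)
qed

lemma set_ell: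
  assumes "n \<ge> 1"
  shows "set (ell n) = {1..n}"
proof
  show "set (ell n) \<subseteq> {1..n}"
    using assms by (auto simp: ell_def)
  show "{1..n} \<subseteq> set (ell n)"
    using assms letter_ell_twice
    by (metis atLeastAtMost_iff length_ell nth_mem subsetI)
qed

text \<open>Otherwise two adjacent letters would recur at the same distance. Gaps of 3 start only at
  odd positions, and gaps of 2 only at 0 and 2m-3, which are not adjacent.\<close>

lemma ell_repeated_factor:
  assumes "m \<ge> 3" "ell m = a @ x @ b @ x @ c"
  shows "length x \<le> 1"
proof (rule ccontr)
  assume x: "\<not> length x \<le> 1"
  let ?p = "length a" and ?q = "length (a @ x @ b)"
  have len: "length (a @ x @ b @ x @ c) = 2 * m"
    using assms by (metis length_ell le_trans one_le_numeral)
  have nth: "ell m ! (?p + i) = x ! i" "ell m ! (?q + i) = x ! i" if "i < length x" for i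
    using that by (simp_all add: assms(2) nth_append)
  have "ell m ! ?p = ell m ! ?q" "ell m ! (?p + 1) = ell m ! (?q + 1)"
    using nth[of 0] nth[of 1] x by (cases x; simp)+
  moreover have "odd (2 * m - 3)" "x \<noteq> []"
    using assms(1) x by (presburger, auto)
  ultimately show False
    using ell_repetition[of m ?p ?q] ell_repetition[of m "?p + 1" "?q + 1"] assms(1) len x by auto
qed

lemma split_list_twice:
  assumes "p < q" "q < length xs" "xs ! p = x" "xs ! q = x"
  obtains a b c where "xs = a @ [x] @ b @ [x] @ c"
proof -
  have "xs = take q xs @ [x] @ drop (Suc q) xs"
    using assms id_take_nth_drop by fastforce
  moreover have "take q xs = take p (take q xs) @ [x] @ drop (Suc p) (take q xs)"
    using assms id_take_nth_drop[of p "take q xs"] by simp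
  ultimately show thesis
    using that by (metis append.assoc)
qed

lemma ell_instance_factor:
  assumes "m \<ge> 3" "n \<ge> 1"
    and factor: "sublist (concat (map \<rho> (ell n))) (ell m)"
    and nonempty: "\<And>x. x \<in> set (ell n) \<Longrightarrow> \<rho> x \<noteq> []"
  shows "n = m \<and> (\<forall>i \<in> {1..m}. \<rho> i = [i])"
proof -
  obtain u v where uv: "ell m = u @ concat (map \<rho> (ell n)) @ v"
    using factor by (auto simp: sublist_def)
  \<comment> \<open>Each letter of \<open>ell n\<close> occurs twice, so its image is a repeated
    factor of \<open>ell m\<close>.\<close>
  have single: "\<rho> i = [hd (\<rho> i)]" if i: "i \<in> set (ell n)" for i
  proof -
    from i have "1 \<le> i" "i \<le> n"
      using assms(2) by (auto simp: set_ell)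
    then obtain p q where "p < q" "q < 2 * n" "ell n ! p = i" "ell n ! q = i"
      by (rule letter_ell_twice)
    then obtain a b c where "ell n = a @ [i] @ b @ [i] @ c"
      using assms(2) split_list_twice by (metis length_ell)
    then have "ell m = (u @ concat (map \<rho> a)) @ \<rho> i @ concat (map \<rho> b) @ \<rho> i @ (concat (map \<rho> c) @ v)"
      using uv by simp
    then have "length (\<rho> i) \<le> 1"
      by (rule ell_repeated_factor[OF assms(1)])
    with nonempty[OF i] show ?thesis
      by (cases "\<rho> i") auto
  qed
  have "concat (map \<rho> (ell n)) = concat (map (\<lambda>i. [hd (\<rho> i)]) (ell n))"
    using single by (intro arg_cong[of _ _ concat] map_cong) auto
  then have uv': "ell m = u @ map (\<lambda>i. hd (\<rho> i)) (ell n) @ v"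
    using uv by (simp add: concat_map_singleton)
  let ?c = "length u"
  have "length (ell m) = 2 * m" "length (ell n) = 2 * n"
    using assms by (auto simp: length_ell)
  then have len: "?c + 2 * n + length v = 2 * m"
    using arg_cong[OF uv', of length] by simp
  have nth: "ell m ! (?c + p) = hd (\<rho> (ell n ! p))" if "p < 2 * n" for p
    using that assms(2) by (simp add: uv' nth_append length_ell)
  have "n \<noteq> 1"
  proof
    assume "n = 1"
    then have "ell m ! ?c = ell m ! (?c + 1)"
      using nth[of 0] nth[of 1] by (simp add: nth_ell)
    then show False
      using ell_repetition[of m ?c "?c + 1"] assms(1) len \<open>n = 1\<close> by auto
  qed
  with assms(2) have n: "n \<ge> 2"
    by simp
  \<comment> \<open>By parity, position 2 is not the last one, so it carries the letter 1.\<close>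
  moreover have "2 * n - 1 \<noteq> 2"
    by presburger
  ultimately have "ell m ! ?c = ell m ! (?c + 2)"
    using nth[of 0] nth[of 2] by (simp add: nth_ell)
  \<comment> \<open>A gap of 2 at 2m-3 would leave room for only three letters, but at least four
    follow.\<close>
  then have c: "?c = 0"
    using ell_repetition[of m ?c "?c + 2"] assms(1) len n by auto
  \<comment> \<open>The final gap of \<open>ell n\<close> is also 2, so it must fall on the final
    gap of \<open>ell m\<close>.\<close>
  have "ell n ! (2 * n - 3) = ell n ! (2 * n - 1)"
    using n by (auto simp: nth_ell)
  then have "ell m ! (2 * n - 3) = ell m ! (2 * n - 1)"
    using nth[of "2 * n - 3"] nth[of "2 * n - 1"] n c by simp
  moreover have "2 * n - 3 < 2 * n - 1" "2 * n - 1 < 2 * m" "2 \<le> m"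
    using assms(1) n len by linarith+
  ultimately have "2 * n - 3 = 0 \<or> 2 * n - 1 = 2 * n - 3 + 3 \<or> 2 * n - 3 = 2 * m - 3"
    using ell_repetition by blast
  then have nm: "n = m"
    using n assms(1) by presburger
  have "\<rho> i = [i]" if "i \<in> {1..m}" for i
  proof -
    from that obtain p where "p < 2 * m" "ell m ! p = i"
      using letter_ell_twice[of i m] by (metis atLeastAtMost_iff)
    then show ?thesis
      using nth[of p] c nm single[of i] that assms by (simp add: set_ell)
  qed
  with nm show ?thesis
    by blast
qed

text \<open>A square is an instance of \<open>ell 1\<close>, and 1 differs from m.\<close>

lemma ell_square_free:
  assumes "m \<ge> 3" "sublist (z @ z) (ell m)"
  shows "z = []"
  using ell_instance_factor[of m 1 "\<lambda>_. z"] assms by (auto simp: ell_def)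

section \<open>Membership in the variety and counting of variables\<close>

lemma factor_alg_remove_letter_in_variety:
  assumes m: "m \<ge> 3" and a: "a \<in> {1..m}"
  shows "factor_alg (ell m) (- {[a]}) \<in> variety Sigma_laws"
proof -
  let ?A = "factor_alg (ell m) (- {[a]})"
  have ell: "eval_trm ?A \<rho> (word (ell n)) = []" if "n \<ge> 1" "range \<rho> \<subseteq> - {[a]}" for n \<rho>
  proof (rule ccontr)
    assume ne: "eval_trm ?A \<rho> (word (ell n)) \<noteq> []"
    have "length (ell n) \<ge> 2"
      using that(1) by (simp add: length_ell)
    then have "ell n \<noteq> []" by auto
    from eval_word_nonzero[OF this ne] \<open>length (ell n) \<ge> 2\<close>
    have "\<rho> a = [a]"
      using ell_instance_factor[OF m that(1)] a by blast
    then show False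
      using that(2) by blast
  qed
  have square: "eval_trm ?A \<rho> (word [0, 0]) = []" for \<rho>
    using ell_square_free[OF m] by (auto simp: mul_factor_alg)
  have "satisfies ?A e" if "e \<in> Sigma_laws" for e
    using that satisfies_free_laws[of e _ "- {[a]}" "ell m"] ell square ell_square_free[OF m]
      satisfies_anticommutative_laws[of e "ell m"]
    unfolding Sigma_laws_def by blast
  then show ?thesis
    by (simp add: variety_def is_alg_factor_alg_remove_letter)
qed

lemma factor_alg_not_in_variety:
  assumes "m \<ge> 1"
  shows "factor_alg (ell m) UNIV \<notin> variety Sigma_laws"
proof -
  have "ell m \<noteq> []"
    by (simp add: ell_def)
  then show ?thesis
    using not_satisfies_free_laws assms by (fastforce simp: variety_def Sigma_laws_def)
qed

lemma satisfies_few_variables: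
  assumes few: "card (vars (fst e) \<union> vars (snd e)) < m"
    and sat: "\<And>a. a \<in> {1..m} \<Longrightarrow> satisfies (factor_alg w (- {[a]})) e"
  shows "satisfies (factor_alg w UNIV) e"
  unfolding satisfies_def
proof (intro allI impI)
  fix \<rho> :: "nat \<Rightarrow> nat list"
  let ?V = "vars (fst e) \<union> vars (snd e)"
  have "card (\<rho> ` ?V) < card ((\<lambda>a. [a]) ` {1..m})"
    using few card_image_le[of ?V \<rho>] by (simp add: card_image inj_on_def)
  then have "\<not> (\<lambda>a. [a]) ` {1..m} \<subseteq> \<rho> ` ?V"
    using card_mono[of "\<rho> ` ?V" "(\<lambda>a. [a]) ` {1..m}"] by (auto simp: not_less[symmetric])
  then obtain a where a: "a \<in> {1..m}" "[a] \<notin> \<rho> ` ?V"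
    by blast
  \<comment> \<open>Variables outside the identity could still take the value \<open>[a]\<close>;
    sending them to zero keeps the assignment inside the subalgebra.\<close>
  define \<sigma> where "\<sigma> x = (if x \<in> ?V then \<rho> x else [])" for x
  have "range \<sigma> \<subseteq> - {[a]}"
    using a(2) by (auto simp: \<sigma>_def)
  then have "eval_trm (factor_alg w (- {[a]})) \<sigma> (fst e) = eval_trm (factor_alg w (- {[a]})) \<sigma> (snd e)"
    using sat[OF a(1)] by (simp add: satisfies_def)
  moreover have "eval_trm (factor_alg w (- {[a]})) \<sigma> t = eval_trm (factor_alg w UNIV) \<rho> t"
    if "vars t \<subseteq> ?V" for t
    using that by (subst eval_factor_alg_carr[of _ _ _ _ UNIV], intro eval_trm_cong) (auto simp: \<sigma>_def)
  ultimately show "eval_trm (factor_alg w UNIV) \<rho> (fst e) = eval_trm (factor_alg w UNIV) \<rho> (snd e)"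
    by simp
qed

theorem theorem4p3:
  assumes "infinite (UNIV :: 'a set)"
  shows "\<not> (\<exists>F. finite F \<and> (variety F :: 'a alg set) = variety Sigma_laws)"
proof
  assume "\<exists>F. finite F \<and> (variety F :: 'a alg set) = variety Sigma_laws"
  then obtain F where F: "finite F" and eq: "(variety F :: 'a alg set) = variety Sigma_laws"
    by blast
  obtain g :: "nat \<Rightarrow> 'a" where "inj g"
    using infinite_countable_subset[OF assms] by blast
  then have inj: "inj (g \<circ> to_nat :: nat list \<Rightarrow> 'a)"
    by (intro inj_compose) simp_all
  have iff: "A \<in> variety F \<longleftrightarrow> A \<in> variety Sigma_laws" for A :: "nat list alg"
    using image_alg_in_variety_iff[OF inj] eq by blast
  let ?V = "\<lambda>e. vars (fst e) \<union> vars (snd e)"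
  \<comment> \<open>Exceeds the number of variables of every identity in \<open>F\<close>; the entry
    3 secures \<open>m >= 3\<close> and covers empty \<open>F\<close>.\<close>
  define m where "m = Max (insert 3 ((\<lambda>e. Suc (card (?V e))) ` F))"
  have m: "m \<ge> 3" "\<And>e. e \<in> F \<Longrightarrow> card (?V e) < m"
    using F by (auto simp: m_def Suc_le_eq[symmetric])
  have "satisfies (factor_alg (ell m) UNIV) e" if e: "e \<in> F" for e
  proof (rule satisfies_few_variables[OF m(2)[OF e]])
    fix a assume "a \<in> {1..m}"
    then have "factor_alg (ell m) (- {[a]}) \<in> variety F"
      using factor_alg_remove_letter_in_variety[OF m(1)] iff by blast
    with e show "satisfies (factor_alg (ell m) (- {[a]})) e"
      by (simp add: variety_def)
  qed
  then have "factor_alg (ell m) UNIV \<in> variety F"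
    by (simp add: variety_def is_alg_factor_alg)
  with iff factor_alg_not_in_variety m(1) show False
    by auto
qed

end
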